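(* Fix any data model $\mathfrak{D}$, any density $\rho\in[0,1]$, and any feasible profile $(D,H)$. For any deterministic eventually consistent generator $\mathcal{B}$ such that $\mu_{low}(\mathcal{B},\infty)=\rho$, there exists a randomized algorithm $\mathcal{A}=\mathcal{A}_{\mathcal{B}}$ achieving $\mu^{\mathrm{pfx}}_{low}(\mathcal{A},D)\ge\rho$ almost surely and, for all countable collections $\mathcal{L}$, $$\sup_{K\in\mathcal{L}}\ \sup_{X\in\mathfrak{D}(K)} H_{\mathcal{A}}^{\mathcal{L},K,X}(t)\le H(t)\qquad\text{for all sufficiently large } t .$$ Furthermore, $\mathcal{A}$ only makes black-box calls to $\mathcal{B}$.
   Context: Game. Fix a countably infinite universe $U=(u_1,u_2,\dots)$ with a fixed bijective enumeration. A language is an infinite subset of $U$; its elements are listed in the order inherited from $U$, $K=(k_1,k_2,\dots)$, and $K_i=\{k_1,\dots,k_i\}$. A collection is a countable collection $\mathcal{L}=(L^1,L^2,\dots)$ of languages with a fixed enumeration. A data model $\mathfrak{D}$ assigns to each language $K$ a set $\mathfrak{D}(K)\subseteq U^{\mathbb{N}}$ of admissible observation sequences $X=(x_1,x_2,\dots)$. A generator $\mathcal{A}$ knows $U$ and $\mathcal{L}$ and is given by (possibly randomized) maps $\mathcal{A}_t:U^t\to U$, $t\ge1$ (which may depend on $\mathcal{L}$); on $X$ it outputs $o_t=\mathcal{A}_t(x_1,\dots,x_t)$, where $o_t$ must differ from all of $o_1,\dots,o_{t-1}$ and $x_1,\dots,x_t$. Write $\mathcal{A}(X)=(o_1,o_2,\dots)$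 and $\mathcal{A}(X)_t=\{o_1,\dots,o_t\}$. The generator is eventually consistent (under $\mathfrak{D}$) if for every $\mathcal{L}$, $K\in\mathcal{L}$, $X\in\mathfrak{D}(K)$ there is a finite $T$ with $o_t\in K$ for all $t\ge T$. Hallucination rate. $H_{\mathcal{A}}^{\mathcal{L},K,X}(t)=\mathbb{E}\big[\,|\mathcal{A}(X)_t\setminus K|/t\,\big]$, expectation over the internal randomness of $\mathcal{A}$. Feasible profile. For $D:\mathbb{N}\to\mathbb{N}$ let $D^{-1}(t)=\min\{n\in\mathbb{N}:D(n)\ge t\}$. $(D,H)$ is a feasible profile if $D:\mathbb{N}\to\mathbb{N}$ is monotone non-decreasing, discrete convex (the increments $D(n+1)-D(n)$ are non-decreasing) and super-linear ($D(n)/n\to\infty$), and $H:\mathbb{N}\to\mathbb{R}_{\ge0}$ is monotone non-increasing with $H(t)\to0$ and $H(t)=\omega(D^{-1}(t)/t)$. Densities. For a deterministic generator $\mathcal{B}$, $\mu_{low}(\mathcal{B},\infty)=\inf_{\mathcal{L}}\inf_{K\in\mathcal{L}}\inf_{X\in\mathfrak{D}(K)}\liminf_{i\to\infty}\frac{|\mathcal{B}(X)\cap K_i|}{i}$, where $\mathcal{B}(X)$ is viewed as the set of all outputs and $\mathcal{L}$ ranges over countable collections. The prefix-wise density is $\mu^{\mathrm{pfx}}_i(\mathcal{A}(X),K,D)=\frac{|\mathcal{A}(X)_{D(i)}\cap K_i|}{i}$. "$\mu^{\mathrm{pfx}}_{low}(\mathcal{A},D)\ge\rho$ almost surely" means: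 for every countable $\mathcal{L}$, $K\in\mathcal{L}$, $X\in\mathfrak{D}(K)$, with probability one over the internal randomness, $\liminf_{i\to\infty}\mu^{\mathrm{pfx}}_i(\mathcal{A}(X),K,D)\ge\rho$. Black-box calls: $\mathcal{A}$ uses $\mathcal{B}$ only through its outputs on the observed prefixes.
   Formalization: A threshold on t uniform over all K and X is impossible in general (two languages whose observations agree arbitrarily long); instead, for every T, the supremum bound is proved for all large t over those K, X on which B is consistent from time T on. *)

theory Defs
  imports "HOL-Probability.Probability" "HOL-Library.Landau_Symbols"
begin

text \<open>The universe is a type \<open>'u\<close> with a bijective enumeration \<open>u :: nat \<Rightarrow> 'u\<close>, which fixes the order
  in which the elements of a language are listed.  A collection is an enumerated sequence of
  languages; repetitions are allowed, so finite collections are included.\<close>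

type_synonym 'u collection = "nat \<Rightarrow> 'u set"

definition collection :: "'u collection \<Rightarrow> bool" where
  "collection L \<longleftrightarrow> (\<forall>j. infinite (L j))"

text \<open>The prefix \<open>K\<^sub>i\<close>: the first \<open>i\<close> elements of \<open>K\<close>.\<close>

definition lang_prefix :: "(nat \<Rightarrow> 'u) \<Rightarrow> 'u set \<Rightarrow> nat \<Rightarrow> 'u set" where
  "lang_prefix u K i = (\<lambda>j. u (enumerate (u -` K) j)) ` {..<i}"

type_synonym 'u data_model = "'u set \<Rightarrow> (nat \<Rightarrow> 'u) set"

text \<open>A deterministic generator maps the collection and the observations \<open>[x\<^sub>1, \<dots>, x\<^sub>t]\<close>, with
  \<open>t \<ge> 1\<close>, to the output \<open>o\<^sub>t\<close>; its value on the empty list is irrelevant.  Observation sequences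
  are indexed from 0, so \<open>x\<^sub>t\<close> is \<open>X (t - 1)\<close>, whereas output times start at 1.\<close>

type_synonym 'u gen = "'u collection \<Rightarrow> 'u list \<Rightarrow> 'u"

definition outp :: "'u gen \<Rightarrow> 'u collection \<Rightarrow> (nat \<Rightarrow> 'u) \<Rightarrow> nat \<Rightarrow> 'u" where
  "outp G L X t = G L (map X [0..<t])"

definition outputs_upto :: "'u gen \<Rightarrow> 'u collection \<Rightarrow> (nat \<Rightarrow> 'u) \<Rightarrow> nat \<Rightarrow> 'u set" where
  "outputs_upto G L X t = outp G L X ` {1..t}"

definition all_outputs :: "'u gen \<Rightarrow> 'u collection \<Rightarrow> (nat \<Rightarrow> 'u) \<Rightarrow> 'u set" where
  "all_outputs G L X = outp G L X ` {1..}"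

definition generator :: "'u gen \<Rightarrow> bool" where
  "generator G \<longleftrightarrow>
     (\<forall>L X. collection L \<longrightarrow>
        (\<forall>t\<ge>1. outp G L X t \<notin> outp G L X ` {1..<t} \<and> outp G L X t \<notin> X ` {..<t}))"

definition consistent_from ::
    "'u gen \<Rightarrow> 'u collection \<Rightarrow> 'u set \<Rightarrow> (nat \<Rightarrow> 'u) \<Rightarrow> nat \<Rightarrow> bool" where
  "consistent_from G L K X T \<longleftrightarrow> (\<forall>t\<ge>1. T \<le> t \<longrightarrow> outp G L X t \<in> K)"

definition eventually_consistent :: "'u data_model \<Rightarrow> 'u gen \<Rightarrow> bool" where
  "eventually_consistent DM G \<longleftrightarrow>
     (\<forall>L. collection L \<longrightarrow> (\<forall>K\<in>range L. \<forall>X\<in>DM K. \<exists>T. consistent_from G L K X T))"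

text \<open>The infima are taken in the extended reals, where an empty infimum is \<open>\<infinity>\<close>.\<close>

definition mu_low :: "(nat \<Rightarrow> 'u) \<Rightarrow> 'u data_model \<Rightarrow> 'u gen \<Rightarrow> ereal" where
  "mu_low u DM G =
     (INF L\<in>{L. collection L}. INF K\<in>range L. INF X\<in>DM K.
        liminf (\<lambda>i. ereal (real (card (all_outputs G L X \<inter> lang_prefix u K i)) / real i)))"

text \<open>A randomized generator is a generator depending on a random seed, drawn once from a
  probability space \<open>M\<close> that carries all the internal randomness.\<close>

type_synonym ('w, 'u) rgen = "'w \<Rightarrow> 'u gen"

definition randomized_generator :: "'w measure \<Rightarrow> ('w, 'u) rgen \<Rightarrow> bool" where
  "randomized_generator M A \<longleftrightarrow>
     prob_space M \<and>
     (\<forall>L xs. (\<lambda>w. A w L xs) \<in> measurable M (count_space UNIV)) \<and>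
     (\<forall>w\<in>space M. generator (A w))"

definition halluc_rate ::
    "'w measure \<Rightarrow> ('w, 'u) rgen \<Rightarrow> 'u collection \<Rightarrow> 'u set \<Rightarrow> (nat \<Rightarrow> 'u) \<Rightarrow> nat \<Rightarrow> real" where
  "halluc_rate M A L K X t =
     prob_space.expectation M (\<lambda>w. real (card (outputs_upto (A w) L X t - K)) / real t)"

definition mu_pfx ::
    "(nat \<Rightarrow> 'u) \<Rightarrow> 'u gen \<Rightarrow> 'u collection \<Rightarrow> 'u set \<Rightarrow> (nat \<Rightarrow> 'u) \<Rightarrow> (nat \<Rightarrow> nat) \<Rightarrow> nat \<Rightarrow> real" where
  "mu_pfx u G L K X D i =
     real (card (outputs_upto G L X (D i) \<inter> lang_prefix u K i)) / real i"

definition mu_pfx_low_ge_AE ::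
    "(nat \<Rightarrow> 'u) \<Rightarrow> 'u data_model \<Rightarrow> 'w measure \<Rightarrow> ('w, 'u) rgen \<Rightarrow> (nat \<Rightarrow> nat) \<Rightarrow> real \<Rightarrow> bool" where
  "mu_pfx_low_ge_AE u DM M A D \<rho> \<longleftrightarrow>
     (\<forall>L. collection L \<longrightarrow> (\<forall>K\<in>range L. \<forall>X\<in>DM K.
        AE w in M. liminf (\<lambda>i. ereal (mu_pfx u (A w) L K X D i)) \<ge> ereal \<rho>))"

text \<open>The natural numbers of a profile start at 1: the values of \<open>D\<close> and \<open>H\<close> at 0 play no role.
  The truncated differences below are genuine ones since \<open>D\<close> is non-decreasing.\<close>

definition D_inv :: "(nat \<Rightarrow> nat) \<Rightarrow> nat \<Rightarrow> nat" where
  "D_inv D t = (LEAST n. 1 \<le> n \<and> t \<le> D n)"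

definition feasible_profile :: "(nat \<Rightarrow> nat) \<Rightarrow> (nat \<Rightarrow> real) \<Rightarrow> bool" where
  "feasible_profile D H \<longleftrightarrow>
     mono_on {1..} D \<and>
     mono_on {1..} (\<lambda>n. D (n + 1) - D n) \<and>
     filterlim (\<lambda>n. real (D n) / real n) at_top sequentially \<and>
     (\<forall>t\<ge>1. 0 \<le> H t) \<and>
     antimono_on {1..} H \<and>
     H \<longlonglongrightarrow> 0 \<and>
     H \<in> \<omega>(\<lambda>t. real (D_inv D t) / real t)"

text \<open>A black-box procedure \<open>P\<close> computes its output at time \<open>t\<close> from its seed, the collection, the
  observations \<open>[x\<^sub>1, \<dots>, x\<^sub>t]\<close> and the answers \<open>[B(x\<^sub>1), B(x\<^sub>1,x\<^sub>2), \<dots>, B(x\<^sub>1,\<dots>,x\<^sub>t)]\<close> of \<open>B\<close> on the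
  observed prefixes.  That \<open>B\<close> is accessed only in this way is meaningful only if \<open>P\<close> is chosen
  before \<open>B\<close>.\<close>

type_synonym ('w, 'u) black_box_proc = "'w \<Rightarrow> 'u collection \<Rightarrow> 'u list \<Rightarrow> 'u list \<Rightarrow> 'u"

definition run_black_box :: "('w, 'u) black_box_proc \<Rightarrow> 'u gen \<Rightarrow> ('w, 'u) rgen" where
  "run_black_box P B w L xs = P w L xs (map (\<lambda>s. B L (take s xs)) [1..<Suc (length xs)])"

text \<open>The generator \<open>A\<close> can follow \<open>B\<close> only once \<open>B\<close> has become consistent, at a time that depends
  on the language and on the observations.  The supremum of the hallucination rate at time \<open>t\<close> is
  therefore taken over all \<open>K\<close> and \<open>X\<close> for which \<open>B\<close> is consistent from time \<open>T\<close> on.  As \<open>T\<close>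
  varies this exhausts all \<open>K\<close> and \<open>X\<close>, for an eventually consistent \<open>B\<close>; a threshold on \<open>t\<close>
  uniform over all of them at once is unattainable, already for two languages whose observations
  agree for an arbitrarily long time.\<close>

definition sup_halluc_rate ::
    "'u data_model \<Rightarrow> 'w measure \<Rightarrow> ('w, 'u) rgen \<Rightarrow> 'u gen \<Rightarrow> 'u collection \<Rightarrow> nat \<Rightarrow> nat \<Rightarrow> ereal" where
  "sup_halluc_rate DM M A B L T t =
     (SUP K\<in>range L. SUP X\<in>{X \<in> DM K. consistent_from B L K X T}.
        ereal (halluc_rate M A L K X t))"

end

theory Submission
  imports Defs
begin

text \<open>The generator repeats the current answer of \<open>B\<close> except at rare random times, when it explores:
  it outputs the first element of some language of the collection that is neither used nor observed.
  After \<open>i\<close> explorations of \<open>K\<close>, every element of \<open>K\<^sub>i\<close> is used or observed, so an answer of \<open>B\<close> in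
  \<open>K\<^sub>i\<close> can be lost only if \<open>B\<close> gives it at the very time of an exploration.  Exploration times are
  uniform in disjoint blocks whose lengths tend to infinity, and \<open>X\<close> does not depend on them.  By
  Hoeffding's inequality and Borel-Cantelli, only \<open>o(i)\<close> answers in \<open>K\<^sub>i\<close> are lost almost surely.

  Between the times \<open>D(i)\<close> and \<open>D(i + 1)\<close> there is one block for each of the first \<open>g(i)\<close> languages,
  where \<open>g\<close> tends to infinity slowly.  So up to a constant every language is explored \<open>i\<close> times by the
  time \<open>D(i)\<close>, while the number of explorations up to time \<open>t\<close> is at most \<open>D\<^sup>-\<^sup>1(t) g(D\<^sup>-\<^sup>1(t))\<close>, which
  \<open>H(t) = \<omega>(D\<^sup>-\<^sup>1(t) / t)\<close> allows to stay below \<open>t H(t) / 2\<close>.\<close>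

section \<open>Following a generator while exploring at scheduled times\<close>

definition fresh :: "(nat \<Rightarrow> 'u) \<Rightarrow> 'u set \<Rightarrow> 'u set \<Rightarrow> 'u" where
  "fresh u K S = u (LEAST n. u n \<in> K \<and> u n \<notin> S)"

text \<open>Times are counted from 0 here: \<open>y t\<close> is the answer of \<open>B\<close> at time \<open>t + 1\<close> of the game.
  \<open>e t = Some m\<close> schedules an exploration of the \<open>m\<close>-th language.  If the answer of \<open>B\<close> is already
  used, any unused element will do: such a step is never counted as a loss.\<close>

definition step ::
    "(nat \<Rightarrow> 'u) \<Rightarrow> (nat \<Rightarrow> nat option) \<Rightarrow> 'u collection \<Rightarrow> (nat \<Rightarrow> 'u) \<Rightarrow> (nat \<Rightarrow> 'u) \<Rightarrow> nat \<Rightarrow> 'u set \<Rightarrow> 'u"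
  where
  "step u e L x y t S =
     (case e t of
        Some m \<Rightarrow> fresh u (L m) (S \<union> x ` {..t})
      | None \<Rightarrow> if y t \<in> S then fresh u (L 0) (S \<union> x ` {..t}) else y t)"

primrec past ::
    "(nat \<Rightarrow> 'u) \<Rightarrow> (nat \<Rightarrow> nat option) \<Rightarrow> 'u collection \<Rightarrow> (nat \<Rightarrow> 'u) \<Rightarrow> (nat \<Rightarrow> 'u) \<Rightarrow> nat \<Rightarrow> 'u set"
  where
  "past u e L x y 0 = {}"
| "past u e L x y (Suc t) = insert (step u e L x y t (past u e L x y t)) (past u e L x y t)"

text \<open>A black-box procedure keeps no memory, so its earlier outputs are recomputed as
  \<open>past\<close> from the seed, the observations and the answers. Only entries up to index
  \<open>t\<close> are read, and they exist when \<open>xs\<close> is nonempty.\<close>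

definition explore_proc ::
    "(nat \<Rightarrow> 'u) \<Rightarrow> ('w \<Rightarrow> nat \<Rightarrow> nat option) \<Rightarrow> ('w, 'u) black_box_proc" where
  "explore_proc u e w L xs ys =
     (let t = length xs - 1
      in step u (e w) L (\<lambda>i. xs ! i) (\<lambda>i. ys ! i) t (past u (e w) L (\<lambda>i. xs ! i) (\<lambda>i. ys ! i) t))"

lemma step_cong:
  assumes "e t = e' t" and "\<And>s. s \<le> t \<Longrightarrow> x s = x' s" and "y t = y' t"
  shows "step u e L x y t S = step u e' L x' y' t S"
proof -
  have "x ` {..t} = x' ` {..t}"
    using assms(2) by (auto simp: image_def)
  then show ?thesis
    using assms by (simp add: step_def cong: option.case_cong)
qed

lemma past_cong:
  assumes "\<And>s. s < t \<Longrightarrow> e s = e' s" and "\<And>s. s < t \<Longrightarrow> x s = x' s" and "\<And>s. s < t \<Longrightarrow> y s = y' s"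
  shows "past u e L x y t = past u e' L x' y' t"
  using assms
proof (induction t)
  case (Suc t)
  have "step u e L x y t S = step u e' L x' y' t S" for S
    by (rule step_cong) (use Suc.prems in auto)
  with Suc show ?case by simp
qed simp

lemma finite_past: "finite (past u e L x y t)"
  by (induction t) auto

lemma past_mono: "s \<le> t \<Longrightarrow> past u e L x y s \<subseteq> past u e L x y t"
  by (rule lift_Suc_mono_le[of "past u e L x y"]) auto

text \<open>Each step reads only data up to its own time, so the finite lists can be replaced by
  infinite sequences. The shift by \<open>Suc\<close> passes from times counted from 0 to game
  times.\<close>

lemma outp_run_explore_proc:
  fixes B :: "'u gen"
  assumes "1 \<le> t"
  shows "outp (run_black_box (explore_proc u e) B w) L X t =
    step u (e w) L X (\<lambda>s. outp B L X (Suc s)) (t - 1)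
      (past u (e w) L X (\<lambda>s. outp B L X (Suc s)) (t - 1))"
proof -
  define xs where "xs = map X [0..<t]"
  define ys where "ys = map (\<lambda>s. B L (take s xs)) [1..<Suc (length xs)]"
  have x: "xs ! s = X s" if "s < t" for s
    using that by (simp add: xs_def)
  have y: "ys ! s = outp B L X (Suc s)" if "s < t" for s
  proof -
    have "ys ! s = B L (take (Suc s) xs)"
      using that by (simp add: ys_def xs_def del: upt_Suc)
    also have "take (Suc s) xs = map X [0..<Suc s]"
      using that by (simp add: xs_def take_map min_def del: upt_Suc)
    finally show ?thesis by (simp add: outp_def)
  qed
  have "outp (run_black_box (explore_proc u e) B w) L X t =
     step u (e w) L (\<lambda>i. xs ! i) (\<lambda>i. ys ! i) (t - 1)
       (past u (e w) L (\<lambda>i. xs ! i) (\<lambda>i. ys ! i) (t - 1))"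
    by (simp add: outp_def run_black_box_def explore_proc_def xs_def ys_def Let_def)
  also have "past u (e w) L (\<lambda>i. xs ! i) (\<lambda>i. ys ! i) (t - 1)
      = past u (e w) L X (\<lambda>s. outp B L X (Suc s)) (t - 1)"
    using assms by (intro past_cong) (auto simp: x y)
  also have "step u (e w) L (\<lambda>i. xs ! i) (\<lambda>i. ys ! i) (t - 1) S
      = step u (e w) L X (\<lambda>s. outp B L X (Suc s)) (t - 1) S" for S
    using assms by (intro step_cong) (auto simp: x y)
  finally show ?thesis .
qed

lemma outputs_upto_Suc: "outputs_upto G L X (Suc t) = insert (outp G L X (Suc t)) (outputs_upto G L X t)"
  by (simp add: outputs_upto_def atLeastAtMostSuc_conv)

lemma outputs_upto_run_explore_proc:
  fixes B :: "'u gen"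
  shows "outputs_upto (run_black_box (explore_proc u e) B w) L X t =
    past u (e w) L X (\<lambda>s. outp B L X (Suc s)) t"
  by (induction t) (simp_all add: outputs_upto_Suc outp_run_explore_proc, simp add: outputs_upto_def)

section \<open>Novelty of the outputs\<close>

lemma fresh_props:
  assumes "bij u" "infinite K" "finite S"
  shows "fresh u K S \<in> K" "fresh u K S \<notin> S"
proof -
  have "infinite (K - S)"
    using assms by simp
  then obtain k where "k \<in> K - S"
    using infinite_imp_nonempty by blast
  moreover obtain n where "k = u n"
    using \<open>bij u\<close> by (meson bij_pointE)
  ultimately have "\<exists>n. u n \<in> K \<and> u n \<notin> S" by auto
  from LeastI_ex[OF this] show "fresh u K S \<in> K" "fresh u K S \<notin> S"
    by (auto simp: fresh_def)
qed

lemma generator_fresh: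
  assumes "generator B" "collection L" "1 \<le> t"
  shows "outp B L X t \<notin> X ` {..<t}"
  using assms by (auto simp: generator_def)

lemma inj_outp:
  assumes "generator B" "collection L"
  shows "inj (\<lambda>s. outp B L X (Suc s))"
proof (rule linorder_injI)
  fix s t :: nat assume "s < t"
  then have "outp B L X (Suc s) \<in> outp B L X ` {1..<Suc t}"
    by (intro imageI) auto
  moreover have "outp B L X (Suc t) \<notin> outp B L X ` {1..<Suc t}"
    using assms unfolding generator_def by simp
  ultimately show "outp B L X (Suc s) \<noteq> outp B L X (Suc t)"
    by metis
qed

lemma generator_run_explore_proc:
  fixes B :: "'u gen"
  assumes "bij u" "generator B"
  shows "generator (run_black_box (explore_proc u e) B w)"
  unfolding generator_def
proof (intro allI impI)
  fix L :: "'u collection" and X :: "nat \<Rightarrow> 'u" and t :: nat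
  assume L: "collection L" and t: "1 \<le> t"
  let ?A = "run_black_box (explore_proc u e) B w"
  let ?y = "\<lambda>s. outp B L X (Suc s)"
  let ?S = "past u (e w) L X ?y (t - 1)"
  have *: "outp ?A L X t = step u (e w) L X ?y (t - 1) ?S"
    using t by (rule outp_run_explore_proc)
  have fr: "fresh u (L m) (?S \<union> X ` {..t-1}) \<notin> ?S \<union> X ` {..t-1}" for m
    using L by (intro fresh_props) (auto simp: assms collection_def finite_past)
  \<comment> \<open>This serves the branch that copies \<open>B\<close>: its answer avoids the
    observations because \<open>B\<close> is a generator, while \<open>step\<close> itself tests
    whether it is already used.\<close>
  have "?y (t - 1) \<notin> X ` {..t - 1}"
    using generator_fresh[OF assms(2) L, of "Suc (t-1)" X] by (simp add: lessThan_Suc_atMost)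
  with fr have "step u (e w) L X ?y (t - 1) ?S \<notin> ?S \<union> X ` {..t-1}"
    unfolding step_def by (auto split: option.split)
  moreover have "outp ?A L X ` {1..<t} = ?S"
    using t outputs_upto_run_explore_proc[of u e B w L X "t - 1"]
    by (auto simp: outputs_upto_def atLeastLessThanSuc_atLeastAtMost[symmetric])
  moreover have "{..t-1} = {..<t}"
    using t by auto
  ultimately show "outp ?A L X t \<notin> outp ?A L X ` {1..<t} \<and> outp ?A L X t \<notin> X ` {..<t}"
    using * by auto
qed

text \<open>When no exploration is scheduled, \<open>step\<close> replaces the answer only if it is
  already used; otherwise it outputs the answer.\<close>

lemma answer_in_past:
  assumes "s < t" "e s = None"
  shows "y s \<in> past u e L x y t"
proof -
  have "y s \<in> past u e L x y (Suc s)"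
    using assms by (auto simp: step_def)
  then show ?thesis
    using past_mono[of "Suc s" t] assms by (metis Suc_leI subsetD)
qed

text \<open>A step that replaces an already used answer of \<open>B\<close> costs nothing: what matters is that all
  but the answers at scheduled explorations have been used.\<close>

lemma card_past_outside_le:
  assumes inj: "inj y" and cons: "\<And>s. T \<le> Suc s \<Longrightarrow> y s \<in> K"
  shows "card (past u e L x y t - K) \<le> T + card {s. s < t \<and> e s \<noteq> None}"
proof -
  let ?P = "past u e L x y t"
  let ?E = "{s. s < t \<and> e s \<noteq> None}"
  \<comment> \<open>At these times the answer lies in \<open>K\<close> and enters the past. By
    injectivity this puts at least \<open>t - T - card ?E\<close> elements of \<open>K\<close> among
    the at most \<open>t\<close> outputs, which leaves at most \<open>T + card ?E\<close>
    outside.\<close>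
  let ?G = "{T..<t} - ?E"
  have sub: "y ` ?G \<subseteq> ?P \<inter> K"
    using cons by (auto intro!: answer_in_past)
  have "t - T - card ?E \<le> card ?G"
    using diff_card_le_card_Diff[of ?E "{T..<t}"] by simp
  also have "card ?G = card (y ` ?G)"
    by (rule card_image[OF inj_on_subset[OF inj subset_UNIV], symmetric])
  also have "\<dots> \<le> card (?P \<inter> K)"
    using sub by (intro card_mono) (auto simp: finite_past)
  finally have *: "t - T - card ?E \<le> card (?P \<inter> K)" .
  have "card ?P \<le> t"
  proof (induction t)
    case (Suc t)
    then show ?case by (simp add: card_insert_if finite_past)
  qed simp
  moreover have "card ?P = card (?P \<inter> K) + card (?P - K)"
    by (rule card_Int_Diff[OF finite_past])
  ultimately show ?thesis
    using * by linarith
qed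

section \<open>Coverage of the prefixes of an explored language\<close>

lemma lang_prefix_Suc:
  "lang_prefix u K (Suc i) = insert (u (enumerate (u -` K) i)) (lang_prefix u K i)"
  by (simp add: lang_prefix_def lessThan_Suc)

lemma finite_lang_prefix: "finite (lang_prefix u K i)"
  by (simp add: lang_prefix_def)

lemma card_lang_prefix_le: "card (lang_prefix u K i) \<le> i"
  by (metis card_image_le card_lessThan finite_lessThan lang_prefix_def)

lemma infinite_vimage_bij: "bij u \<Longrightarrow> infinite K \<Longrightarrow> infinite (u -` K)"
  by (metis bij_is_surj finite_imageI surj_image_vimage_eq)

text \<open>Both \<open>fresh\<close> and the listing of \<open>K\<close> follow the order of
  \<open>u\<close>. If the first \<open>n\<close> elements are in \<open>S\<close> and the next one
  is not, that one is the least candidate.\<close>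

lemma lang_prefix_covers_fresh:
  assumes "bij u" "infinite K" "lang_prefix u K n \<subseteq> S"
  shows "lang_prefix u K (Suc n) \<subseteq> insert (fresh u K S) S"
proof (cases "u (enumerate (u -` K) n) \<in> S")
  case True
  then show ?thesis using assms by (auto simp: lang_prefix_Suc)
next
  case False
  have inf: "infinite (u -` K)"
    using assms by (rule_tac infinite_vimage_bij)
  have "(LEAST n. u n \<in> K \<and> u n \<notin> S) = enumerate (u -` K) n"
  proof (rule Least_equality)
    show "u (enumerate (u -` K) n) \<in> K \<and> u (enumerate (u -` K) n) \<notin> S"
      using False enumerate_in_set[OF inf, of n] by auto
  next
    fix m assume m: "u m \<in> K \<and> u m \<notin> S"
    then obtain j where j: "m = enumerate (u -` K) j"
      using enumerate_Ex[OF inf, of m] by auto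
    show "enumerate (u -` K) n \<le> m"
    proof (rule ccontr)
      assume "\<not> ?thesis"
      then have "j < n" using j inf enumerate_mono_iff by (metis not_le)
      then have "u m \<in> S" using assms j by (auto simp: lang_prefix_def)
      with m show False by simp
    qed
  qed
  then show ?thesis using assms by (auto simp: lang_prefix_Suc fresh_def)
qed

text \<open>Each exploration extends the covered prefix by one element, and no other step uncovers
  anything. Observed elements must count as covered because \<open>fresh\<close> skips them.\<close>

lemma lang_prefix_covered:
  assumes "bij u" "infinite (L m)"
  shows "lang_prefix u (L m) (card {s. s < t \<and> e s = Some m}) \<subseteq> past u e L x y t \<union> x ` {..<t}"
proof (induction t)
  case 0
  then show ?case by (simp add: lang_prefix_def)
next
  case (Suc t)
  show ?case
  proof (cases "e t = Some m")
    case True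
    have "{s. s < Suc t \<and> e s = Some m} = insert t {s. s < t \<and> e s = Some m}"
      using True by (auto simp: less_Suc_eq)
    then have c: "card {s. s < Suc t \<and> e s = Some m} = Suc (card {s. s < t \<and> e s = Some m})"
      by simp
    let ?S = "past u e L x y t \<union> x ` {..t}"
    have "lang_prefix u (L m) (Suc (card {s. s < t \<and> e s = Some m})) \<subseteq> insert (fresh u (L m) ?S) ?S"
      using Suc by (intro lang_prefix_covers_fresh assms) (auto simp: lessThan_Suc_atMost[symmetric])
    then show ?thesis
      using True by (simp add: c step_def lessThan_Suc_atMost)
  next
    case False
    then have "{s. s < Suc t \<and> e s = Some m} = {s. s < t \<and> e s = Some m}"
      by (auto simp: less_Suc_eq)
    then show ?thesis using Suc by (auto simp: less_Suc_eq)
  qed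
qed

text \<open>An element that \<open>B\<close> outputs at time \<open>s\<close> and that is covered by an observation is observed
  only after \<open>s\<close>.  Hence it can be missed only if \<open>s\<close> is a scheduled exploration.\<close>

lemma card_answers_prefix_le:
  assumes u: "bij u" "infinite (L m)" and inj: "inj y" and y: "\<And>s. y s \<notin> x ` {..s}"
    and n: "i \<le> card {s. s < t \<and> e s = Some m} + c"
  shows "card (range y \<inter> lang_prefix u (L m) i)
     \<le> card (past u e L x y t \<inter> lang_prefix u (L m) i) + c
        + card {s. y s \<in> lang_prefix u (L m) i \<and> e s \<noteq> None}"
proof -
  let ?K = "lang_prefix u (L m)"
  let ?P = "past u e L x y t"
  let ?R = "{s. y s \<in> ?K i \<and> e s \<noteq> None}"
  \<comment> \<open>At least \<open>i - c\<close> explorations took place before \<open>t\<close>,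
    so only the last \<open>c\<close> elements of the prefix may be uncovered.\<close>
  let ?V = "(\<lambda>j. u (enumerate (u -` L m) j)) ` {i - c..<i}"
  have finR: "finite ?R"
    by (rule finite_subset[of _ "y -` ?K i"])
      (auto intro!: finite_vimageI finite_lang_prefix inj)
  have "range y \<inter> ?K i \<subseteq> (?P \<inter> ?K i) \<union> ?V \<union> y ` ?R"
  proof
    fix k assume "k \<in> range y \<inter> ?K i"
    then obtain s where k: "k = y s" "k \<in> ?K i" by blast
    then obtain j where j: "j < i" "k = u (enumerate (u -` L m) j)"
      unfolding lang_prefix_def by blast
    show "k \<in> (?P \<inter> ?K i) \<union> ?V \<union> y ` ?R"
    proof (cases "i - c \<le> j \<or> k \<in> ?P")
      case True
      then show ?thesis using j k by auto
    next
      case False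
      then have "j < card {s. s < t \<and> e s = Some m}" using n by auto
      then have "k \<in> ?K (card {s. s < t \<and> e s = Some m})"
        using j by (auto simp: lang_prefix_def)
      then obtain r where r: "r < t" "k = x r"
        using lang_prefix_covered[of u L m, OF u] False by blast
      then have "s < r" using y[of s] k by (metis atMost_iff imageI not_le)
      then have "e s \<noteq> None"
        using answer_in_past[of s t e y] r k False by fastforce
      then show ?thesis using k by auto
    qed
  qed
  then have "card (range y \<inter> ?K i) \<le> card ((?P \<inter> ?K i) \<union> ?V \<union> y ` ?R)"
    by (intro card_mono finite_UnI finite_Int disjI1 finite_past finite_imageI finR) auto
  also have "\<dots> \<le> card (?P \<inter> ?K i) + card ?V + card (y ` ?R)"
    by (meson add_le_mono1 card_Un_le le_trans)
  also have "card (y ` ?R) = card ?R"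
    by (rule card_image[OF inj_on_subset[OF inj subset_UNIV]])
  also have "card ?V \<le> c"
    using card_image_le[of "{i - c..<i}" "\<lambda>j. u (enumerate (u -` L m) j)"] by simp
  finally show ?thesis by simp
qed

section \<open>One uniformly random exploration in each of disjoint blocks of times\<close>

text \<open>The last assumption says that block lengths tend to infinity along \<open>Bl\<close>.
  Lengths are positive at every index because \<open>seed\<close> draws a uniform coordinate for
  each of them.\<close>

locale block_schedule =
  fixes Bl :: "nat set" and a q lab :: "nat \<Rightarrow> nat"
  assumes q_pos: "0 < q b"
    and disjoint: "b \<in> Bl \<Longrightarrow> b' \<in> Bl \<Longrightarrow> b \<noteq> b' \<Longrightarrow> {a b..<a b + q b} \<inter> {a b'..<a b' + q b'} = {}"
    and few_short: "finite {b \<in> Bl. q b \<le> c}"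
begin

text \<open>Reduction modulo \<open>q b\<close> keeps the hit inside its block for every seed, not
  just almost surely. Under \<open>seed\<close> the coordinate is an integer below
  \<open>q b\<close> almost surely, so the reduction does not disturb uniformity.\<close>

definition hit :: "(nat \<Rightarrow> real) \<Rightarrow> nat \<Rightarrow> nat" where
  "hit w b = a b + nat \<lfloor>w b\<rfloor> mod q b"

definition sched :: "(nat \<Rightarrow> real) \<Rightarrow> nat \<Rightarrow> nat option" where
  "sched w s = (if \<exists>b\<in>Bl. hit w b = s then Some (lab (THE b. b \<in> Bl \<and> hit w b = s)) else None)"

definition seed :: "(nat \<Rightarrow> real) measure" where
  "seed = PiM UNIV (\<lambda>b. measure_pmf (map_pmf real (pmf_of_set {..<q b})))"

lemma hit_in: "hit w b \<in> {a b..<a b + q b}"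
  using q_pos[of b] by (simp add: hit_def)

lemma hit_inj: "b \<in> Bl \<Longrightarrow> b' \<in> Bl \<Longrightarrow> hit w b = hit w b' \<Longrightarrow> b = b'"
  using disjoint hit_in by (metis IntI empty_iff)

lemma inj_on_hit: "inj_on (hit w) Bl"
  using hit_inj by (auto intro: inj_onI)

lemma sched_hit: "b \<in> Bl \<Longrightarrow> sched w (hit w b) = Some (lab b)"
proof -
  assume b: "b \<in> Bl"
  then have "(THE b'. b' \<in> Bl \<and> hit w b' = hit w b) = b"
    using hit_inj by blast
  with b show ?thesis by (auto simp: sched_def)
qed

lemma sched_eq_Some_iff: "sched w s = Some m \<longleftrightarrow> (\<exists>b\<in>Bl. hit w b = s \<and> lab b = m)"
  using sched_hit by (metis option.distinct(1) option.inject sched_def)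

lemma sched_eq_None_iff: "sched w s = None \<longleftrightarrow> (\<forall>b\<in>Bl. hit w b \<noteq> s)"
  by (auto simp: sched_def)

text \<open>A block that yields an exploration before \<open>t\<close> must start before
  \<open>t\<close>. As this holds for every seed, the hallucinations can be bounded
  pointwise.\<close>

lemma card_sched_le:
  assumes "finite {b \<in> Bl. a b < t}"
  shows "card {s. s < t \<and> sched w s \<noteq> None} \<le> card {b \<in> Bl. a b < t}"
proof (rule surj_card_le[OF assms])
  show "{s. s < t \<and> sched w s \<noteq> None} \<subseteq> hit w ` {b \<in> Bl. a b < t}"
  proof
    fix s assume "s \<in> {s. s < t \<and> sched w s \<noteq> None}"
    then obtain b where "b \<in> Bl" "hit w b = s" "s < t"
      unfolding mem_Collect_eq sched_eq_None_iff by blast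
    then show "s \<in> hit w ` {b \<in> Bl. a b < t}"
      using hit_in[of w b] by auto
  qed
qed

lemma card_sched_label_ge:
  "card {b \<in> Bl. lab b = m \<and> a b + q b \<le> t} \<le> card {s. s < t \<and> sched w s = Some m}"
proof -
  let ?B = "{b \<in> Bl. lab b = m \<and> a b + q b \<le> t}"
  have "card ?B = card (hit w ` ?B)"
    by (rule card_image[symmetric], rule inj_on_subset[OF inj_on_hit]) auto
  also have "\<dots> \<le> card {s. s < t \<and> sched w s = Some m}"
  proof (rule card_mono)
    show "hit w ` ?B \<subseteq> {s. s < t \<and> sched w s = Some m}"
    proof
      fix s assume "s \<in> hit w ` ?B"
      then obtain b where "b \<in> ?B" "s = hit w b" by blast
      then show "s \<in> {s. s < t \<and> sched w s = Some m}"
        using hit_in[of w b] sched_hit[of b w] by auto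
    qed
  qed simp
  finally show ?thesis .
qed

section \<open>Independence, means and concentration of the hits\<close>

lemma prob_space_seed: "prob_space seed"
  unfolding seed_def by (intro prob_space_PiM measure_pmf.prob_space_axioms)

sublocale prob_space seed
  by (rule prob_space_seed)

lemma space_seed [simp]: "space seed = UNIV"
  by (simp add: seed_def space_PiM)

lemma measurable_coordinate: "(\<lambda>w. w b) \<in> measurable seed (count_space UNIV)"
proof -
  have "(\<lambda>w. w b) \<in> measurable seed (measure_pmf (map_pmf real (pmf_of_set {..<q b})))"
    unfolding seed_def by (rule measurable_component_singleton) simp
  then show ?thesis
    by (simp cong: measurable_cong_sets)
qed

lemma measurable_hit [measurable]: "(\<lambda>w. hit w b) \<in> measurable seed (count_space UNIV)"
proof -
  have "(\<lambda>r :: real. a b + nat \<lfloor>r\<rfloor> mod q b) \<in> measurable (count_space UNIV) (count_space UNIV)"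
    by simp
  from measurable_compose[OF measurable_coordinate this] show ?thesis
    by (simp add: hit_def)
qed

lemma measurable_sched: "(\<lambda>w. sched w s) \<in> measurable seed (count_space UNIV)"
proof -
  have "(\<lambda>w. sched w s) -` {v} \<inter> space seed \<in> sets seed" for v
  proof (cases v)
    case None
    have "{w \<in> space seed. \<forall>b\<in>Bl. hit w b \<noteq> s} \<in> sets seed"
      by measurable
    then show ?thesis
      by (simp add: None vimage_def sched_eq_None_iff)
  next
    case (Some m)
    have "{w \<in> space seed. \<exists>b\<in>Bl. hit w b = s \<and> lab b = m} \<in> sets seed"
      by measurable
    then show ?thesis
      by (simp add: Some vimage_def sched_eq_Some_iff)
  qed
  then show ?thesis
    by (simp add: measurable_count_space_eq2_countable)
qed

lemma indep_coordinates: "indep_vars (\<lambda>_. count_space UNIV) (\<lambda>b w. w b) UNIV"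
proof -
  let ?N = "\<lambda>b. measure_pmf (map_pmf real (pmf_of_set {..<q b}))"
  have "indep_vars ?N (\<lambda>b w. w b) UNIV"
  proof (subst indep_vars_iff_distr_eq_PiM')
    show "distr seed (PiM UNIV ?N) (\<lambda>w. \<lambda>b\<in>UNIV. w b) = PiM UNIV (\<lambda>b. distr seed (?N b) (\<lambda>w. w b))"
      unfolding seed_def
      by (subst distr_PiM_component) (auto simp: measure_pmf.prob_space_axioms restrict_def distr_id)
  next
    show "random_variable (?N b) (\<lambda>w. w b)" for b
      unfolding seed_def by (rule measurable_component_singleton) simp
  qed simp
  from indep_vars_compose2[OF this, of "\<lambda>_ r. r" "\<lambda>_. count_space UNIV"] show ?thesis
    by simp
qed

lemma indep_hit_indicator:
  "indep_vars (\<lambda>_. borel) (\<lambda>b w. indicator S (hit w b) :: real) J"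
proof -
  have "indep_vars (\<lambda>_. borel) (\<lambda>b w. indicator S (a b + nat \<lfloor>w b\<rfloor> mod q b) :: real) UNIV"
    by (rule indep_vars_compose2[OF indep_coordinates,
          of "\<lambda>b r. indicator S (a b + nat \<lfloor>r\<rfloor> mod q b)"]) simp
  then show ?thesis
    unfolding hit_def by (rule indep_vars_subset) simp
qed

lemma expectation_hit_indicator:
  "expectation (\<lambda>w. indicator S (hit w b)) = real (card ({a b..<a b + q b} \<inter> S)) / real (q b)"
proof -
  let ?p = "pmf_of_set {..<q b}"
  let ?f = "\<lambda>r :: real. indicator S (a b + nat \<lfloor>r\<rfloor> mod q b) :: real"
  let ?A = "{k. k < q b \<and> a b + k \<in> S}"
  have ne: "{..<q b} \<noteq> {}"
    using q_pos[of b] by auto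
  have "expectation (\<lambda>w. indicator S (hit w b)) = expectation (\<lambda>w. ?f (w b))"
    by (simp add: hit_def)
  also have "\<dots> = integral\<^sup>L (distr seed (map_pmf real ?p) (\<lambda>w. w b)) ?f"
    by (rule integral_distr[symmetric])
      (auto intro: measurable_coordinate simp: measurable_coordinate cong: measurable_cong_sets)
  also have "distr seed (map_pmf real ?p) (\<lambda>w. w b) = map_pmf real ?p"
    unfolding seed_def by (subst distr_PiM_component) (auto simp: measure_pmf.prob_space_axioms)
  also have "integral\<^sup>L (map_pmf real ?p) ?f = measure_pmf.expectation ?p (\<lambda>k. ?f (real k))"
    by simp
  also have "\<dots> = (\<Sum>k<q b. ?f (real k)) / real (q b)"
    using ne by (simp add: integral_pmf_of_set)
  also have "(\<Sum>k<q b. ?f (real k)) = (\<Sum>k<q b. indicator {k. a b + k \<in> S} k)"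
    by (intro sum.cong) (auto simp: indicator_def)
  also have "\<dots> = real (card ({..<q b} \<inter> {k. a b + k \<in> S}))"
    by (simp add: indicator_def sum.If_cases)
  also have "{..<q b} \<inter> {k. a b + k \<in> S} = ?A" by auto
  also have "card ?A = card ({a b..<a b + q b} \<inter> S)"
  proof (rule bij_betw_same_card[of "\<lambda>k. a b + k"], rule bij_betwI[where g = "\<lambda>s. s - a b"])
  qed (auto intro: less_diff_conv2[THEN iffD2])
  finally show ?thesis .
qed

text \<open>By disjointness each time lies in at most one block. This bounds the number of summands
  in Hoeffding's inequality.\<close>

lemma card_blocks_meeting_le:
  assumes "finite S"
  shows "finite {b \<in> Bl. {a b..<a b + q b} \<inter> S \<noteq> {}}"
    and "card {b \<in> Bl. {a b..<a b + q b} \<inter> S \<noteq> {}} \<le> card S"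
proof -
  let ?B = "\<lambda>s. {b \<in> Bl. s \<in> {a b..<a b + q b}}"
  have eq: "{b \<in> Bl. {a b..<a b + q b} \<inter> S \<noteq> {}} = (\<Union>s\<in>S. ?B s)"
    by auto
  have one: "finite (?B s) \<and> card (?B s) \<le> 1" for s
  proof (cases "?B s = {}")
    case False
    then obtain b where b: "b \<in> ?B s" by blast
    then have sub: "?B s \<subseteq> {b}"
      using disjoint[of b] by blast
    then have "finite (?B s)" by (rule finite_subset) simp
    moreover have "card (?B s) \<le> card {b}"
      using sub by (rule card_mono[rotated]) simp
    ultimately show ?thesis by simp
  qed (simp only:, simp)
  show "finite {b \<in> Bl. {a b..<a b + q b} \<inter> S \<noteq> {}}"
    unfolding eq using assms one by blast
  have "card (\<Union>s\<in>S. ?B s) \<le> (\<Sum>s\<in>S. card (?B s))"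
    using assms by (rule card_UN_le)
  also have "\<dots> \<le> (\<Sum>s\<in>S. 1)"
    using one by (intro sum_mono) blast
  finally show "card {b \<in> Bl. {a b..<a b + q b} \<inter> S \<noteq> {}} \<le> card S"
    unfolding eq by simp
qed

text \<open>In a block longer than \<open>1 / \<epsilon>\<close> a fixed time is hit with probability at most \<open>\<epsilon>\<close>; the constant
  \<open>C\<close> counts the finitely many other blocks.\<close>

lemma mean_hits_le:
  assumes "0 < \<epsilon>"
  shows "\<exists>C::real. \<forall>Q S. finite Q \<longrightarrow> Q \<subseteq> Bl \<longrightarrow> finite S \<longrightarrow>
    (\<Sum>b\<in>Q. real (card ({a b..<a b + q b} \<inter> S)) / real (q b)) \<le> C + \<epsilon> * real (card S)"
proof (rule exI, intro allI impI)
  define F where "F = {b \<in> Bl. q b \<le> nat \<lfloor>1 / \<epsilon>\<rfloor>}"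
  have F: "finite F"
    unfolding F_def by (rule few_short)
  fix Q S :: "nat set"
  assume Q: "finite Q" "Q \<subseteq> Bl" and S: "finite S"
  let ?I = "\<lambda>b. {a b..<a b + q b} \<inter> S"
  let ?r = "\<lambda>b. real (card (?I b)) / real (q b)"
  have "?r b \<le> 1" for b
    using q_pos[of b] card_mono[of "{a b..<a b + q b}" "?I b"] by auto
  then have "(\<Sum>b\<in>Q \<inter> F. ?r b) \<le> (\<Sum>b\<in>Q \<inter> F. 1)"
    by (intro sum_mono)
  also have "\<dots> \<le> real (card F)"
    using F by (simp add: card_mono)
  finally have 1: "(\<Sum>b\<in>Q \<inter> F. ?r b) \<le> real (card F)" .
  have "?r b \<le> \<epsilon> * real (card (?I b))" if "b \<in> Q - F" for b
  proof -
    have "nat \<lfloor>1 / \<epsilon>\<rfloor> < q b"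
      using that Q by (auto simp: F_def)
    then have "1 / \<epsilon> < real (q b)"
      by linarith
    then have "1 / real (q b) \<le> \<epsilon>"
      using assms q_pos[of b] by (simp add: field_simps)
    then have "1 / real (q b) * real (card (?I b)) \<le> \<epsilon> * real (card (?I b))"
      by (intro mult_right_mono) auto
    then show ?thesis by simp
  qed
  then have "(\<Sum>b\<in>Q - F. ?r b) \<le> (\<Sum>b\<in>Q - F. \<epsilon> * real (card (?I b)))"
    by (rule sum_mono)
  also have "\<dots> = \<epsilon> * real (\<Sum>b\<in>Q - F. card (?I b))"
    by (simp add: sum_distrib_left)
  also have "(\<Sum>b\<in>Q - F. card (?I b)) = card (\<Union>b\<in>Q - F. ?I b)"
  proof (rule card_UN_disjoint[symmetric])
    show "\<forall>i\<in>Q - F. \<forall>j\<in>Q - F. i \<noteq> j \<longrightarrow> ?I i \<inter> ?I j = {}"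
      using disjoint Q by blast
  qed (use Q S in auto)
  also have "\<epsilon> * real (card (\<Union>b\<in>Q - F. ?I b)) \<le> \<epsilon> * real (card S)"
    using assms S by (intro mult_left_mono of_nat_mono card_mono) auto
  finally have 2: "(\<Sum>b\<in>Q - F. ?r b) \<le> \<epsilon> * real (card S)" .
  have "(\<Sum>b\<in>Q. ?r b) = (\<Sum>b\<in>Q \<inter> F. ?r b) + (\<Sum>b\<in>Q - F. ?r b)"
    by (rule sum.Int_Diff[OF Q(1)])
  with 1 2 show "(\<Sum>b\<in>Q. ?r b) \<le> real (card F) + \<epsilon> * real (card S)" by linarith
qed

text \<open>This is the form needed for Hoeffding's inequality: a finite sum of independent
  indicators. Distinct blocks have distinct hits, so nothing is counted twice.\<close>

lemma card_sched_in_eq: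
  assumes "finite S"
  shows "real (card {s \<in> S. sched w s \<noteq> None})
    = (\<Sum>b\<in>{b \<in> Bl. {a b..<a b + q b} \<inter> S \<noteq> {}}. indicator S (hit w b))"
proof -
  let ?Q = "{b \<in> Bl. {a b..<a b + q b} \<inter> S \<noteq> {}}"
  have eq: "{s \<in> S. sched w s \<noteq> None} = hit w ` {b \<in> ?Q. hit w b \<in> S}"
  proof (intro set_eqI iffI)
    fix s assume "s \<in> {s \<in> S. sched w s \<noteq> None}"
    then obtain b where "b \<in> Bl" "hit w b = s" "s \<in> S"
      unfolding mem_Collect_eq sched_eq_None_iff by blast
    then show "s \<in> hit w ` {b \<in> ?Q. hit w b \<in> S}"
      using hit_in[of w b] by blast
  next
    fix s assume "s \<in> hit w ` {b \<in> ?Q. hit w b \<in> S}"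
    then show "s \<in> {s \<in> S. sched w s \<noteq> None}"
      using sched_hit by auto
  qed
  have "card {s \<in> S. sched w s \<noteq> None} = card {b \<in> ?Q. hit w b \<in> S}"
    unfolding eq by (rule card_image, rule inj_on_subset[OF inj_on_hit]) auto
  moreover have "real (card {b \<in> Q. hit w b \<in> S}) = (\<Sum>b\<in>Q. indicator S (hit w b))"
    if "finite Q" for Q
    using sum.inter_filter[OF that, of "\<lambda>_. 1 :: real" "\<lambda>b. hit w b \<in> S"]
    unfolding indicator_def of_bool_def by simp
  ultimately show ?thesis
    using card_blocks_meeting_le(1)[OF assms] by presburger
qed

text \<open>Hoeffding's inequality for a deviation of \<epsilon> i above the mean, with at most
  \<open>card S\<close>, hence at most \<open>i\<close>, summands in [0,1]. An empty sum is treated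
  apart, since the inequality divides by the number of summands.\<close>

lemma prob_many_hits_le:
  assumes S: "finite S" "card S \<le> i" and i: "0 < i" and \<epsilon>: "0 < \<epsilon>"
    and \<mu>: "(\<Sum>b\<in>{b \<in> Bl. {a b..<a b + q b} \<inter> S \<noteq> {}}.
             real (card ({a b..<a b + q b} \<inter> S)) / real (q b)) \<le> \<epsilon> * real i"
  shows "prob {w. 2 * \<epsilon> * real i \<le> real (card {s \<in> S. sched w s \<noteq> None})} \<le> exp (- 2 * \<epsilon>\<^sup>2 * real i)"
proof (cases "{b \<in> Bl. {a b..<a b + q b} \<inter> S \<noteq> {}} = {}")
  case True
  have "{w. 2 * \<epsilon> * real i \<le> real (card {s \<in> S. sched w s \<noteq> None})} = {}"
    unfolding card_sched_in_eq[OF S(1)] True using i \<epsilon> by (auto simp: not_le)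
  then show ?thesis by simp
next
  case False
  let ?Q = "{b \<in> Bl. {a b..<a b + q b} \<inter> S \<noteq> {}}"
  let ?Z = "\<lambda>b w. indicator S (hit w b) :: real"
  interpret Hf: Hoeffding_ineq seed ?Q ?Z "\<lambda>_. 0" "\<lambda>_. 1" "\<Sum>b\<in>?Q. expectation (?Z b)"
  proof unfold_locales
    show "indep_vars (\<lambda>_. borel) ?Z ?Q" by (rule indep_hit_indicator)
    show "finite ?Q" by (rule card_blocks_meeting_le(1)[OF S(1)])
    show "AE w in seed. ?Z b w \<in> {0..1}" for b by (simp add: indicator_def)
  qed
  have \<mu>': "(\<Sum>b\<in>?Q. expectation (?Z b)) \<le> \<epsilon> * real i"
    using \<mu> by (simp add: expectation_hit_indicator)
  have c: "0 < card ?Q" "card ?Q \<le> i"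
    using False card_blocks_meeting_le[OF S(1)] S(2) by (simp_all add: card_gt_0_iff)
  have "prob {w. 2 * \<epsilon> * real i \<le> real (card {s \<in> S. sched w s \<noteq> None})}
      \<le> prob {w \<in> space seed. (\<Sum>b\<in>?Q. expectation (?Z b)) + \<epsilon> * real i \<le> (\<Sum>b\<in>?Q. ?Z b w)}"
    unfolding card_sched_in_eq[OF S(1)]
  proof (rule finite_measure_mono)
    show "{w \<in> space seed. (\<Sum>b\<in>?Q. expectation (?Z b)) + \<epsilon> * real i \<le> (\<Sum>b\<in>?Q. ?Z b w)} \<in> events"
      by measurable
  qed (use \<mu>' in auto)
  also have "\<dots> \<le> exp (- 2 * (\<epsilon> * real i)\<^sup>2 / (\<Sum>b\<in>?Q. (1 - 0)\<^sup>2))"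
    by (rule Hf.Hoeffding_ineq_ge) (use c \<epsilon> in auto)
  also have "\<dots> = exp (- (2 * \<epsilon>\<^sup>2 * real i * (real i / real (card ?Q))))"
    by (simp add: power2_eq_square mult_ac)
  also have "\<dots> \<le> exp (- (2 * \<epsilon>\<^sup>2 * real i))"
  proof -
    have "2 * \<epsilon>\<^sup>2 * real i * 1 \<le> 2 * \<epsilon>\<^sup>2 * real i * (real i / real (card ?Q))"
      using c \<epsilon> by (intro mult_left_mono) auto
    then show ?thesis by simp
  qed
  finally show ?thesis by simp
qed

lemma measurable_card_sched_in:
  assumes "finite S"
  shows "{w. c \<le> real (card {s \<in> S. sched w s \<noteq> None})} \<in> events"
proof -
  have "{w \<in> space seed. c \<le> (\<Sum>b\<in>{b \<in> Bl. {a b..<a b + q b} \<inter> S \<noteq> {}}. indicator S (hit w b))} \<in> events"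
    by measurable
  then show ?thesis
    by (simp only: card_sched_in_eq[OF assms] space_seed UNIV_I simp_thms)
qed

text \<open>The exceptional probabilities are eventually below a geometric sequence, so
  Borel-Cantelli applies. It is essential that the sets \<open>S i\<close> do not depend on the
  seed.\<close>

lemma AE_eventually_few_hits:
  assumes S: "\<And>i. finite (S i)" "\<And>i. card (S i) \<le> i" and \<epsilon>: "0 < \<epsilon>"
  shows "AE w in seed. \<forall>\<^sub>F i in sequentially.
    real (card {s \<in> S i. sched w s \<noteq> None}) < 2 * \<epsilon> * real i"
proof -
  \<comment> \<open>The other half of \<epsilon> absorbs the constant \<open>C\<close> once
    \<open>i\<close> exceeds 2 C / \<epsilon>.\<close>
  have "0 < \<epsilon> / 2" using \<epsilon> by simp
  then obtain C where C:
    "\<And>Q S. finite Q \<Longrightarrow> Q \<subseteq> Bl \<Longrightarrow> finite S \<Longrightarrow>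
       (\<Sum>b\<in>Q. real (card ({a b..<a b + q b} \<inter> S)) / real (q b)) \<le> C + \<epsilon> / 2 * real (card S)"
    using mean_hits_le by blast
  let ?E = "\<lambda>i. {w. 2 * \<epsilon> * real i \<le> real (card {s \<in> S i. sched w s \<noteq> None})}"
  have "\<forall>\<^sub>F i in sequentially. prob (?E i) \<le> exp (- 2 * \<epsilon>\<^sup>2) ^ i"
    using eventually_gt_at_top[of "nat \<lceil>2 * C / \<epsilon>\<rceil>"]
  proof eventually_elim
    case (elim i)
    then have "2 * C / \<epsilon> \<le> real i" by linarith
    then have "C \<le> \<epsilon> / 2 * real i"
      using \<epsilon> by (simp add: field_simps)
    moreover have "\<epsilon> / 2 * real (card (S i)) \<le> \<epsilon> / 2 * real i"
      using S(2)[of i] \<epsilon> by (intro mult_left_mono) auto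
    ultimately have *: "C + \<epsilon> / 2 * real (card (S i)) \<le> \<epsilon> * real i" by linarith
    have "prob (?E i) \<le> exp (- 2 * \<epsilon>\<^sup>2 * real i)"
    proof (rule prob_many_hits_le[OF S])
      show "(\<Sum>b\<in>{b \<in> Bl. {a b..<a b + q b} \<inter> S i \<noteq> {}}.
             real (card ({a b..<a b + q b} \<inter> S i)) / real (q b)) \<le> \<epsilon> * real i"
        by (rule order_trans[OF C *]) (auto intro: S card_blocks_meeting_le)
    qed (use elim \<epsilon> in auto)
    then show ?case
      by (simp flip: exp_of_nat_mult add: mult_ac)
  qed
  then have "\<forall>\<^sub>F i in sequentially. norm (prob (?E i)) \<le> exp (- 2 * \<epsilon>\<^sup>2) ^ i"
    by (simp only: real_norm_def abs_of_nonneg measure_nonneg)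
  moreover have "summable (\<lambda>i. exp (- 2 * \<epsilon>\<^sup>2) ^ i)"
    using \<epsilon> by (intro summable_geometric) simp
  ultimately have "summable (\<lambda>i. prob (?E i))"
    by (rule summable_comparison_test_ev)
  then have "AE w in seed. \<forall>\<^sub>F i in sequentially. w \<in> space seed - ?E i"
  proof (rule borel_cantelli_AE1[rotated 2])
    show "?E i \<in> events" for i
      by (rule measurable_card_sched_in[OF S(1)])
    show "emeasure seed (?E i) < \<infinity>" for i
      by (simp only: emeasure_eq_measure ennreal_less_top infinity_ennreal_def)
  qed
  then show ?thesis
    by (simp only: Diff_iff mem_Collect_eq not_le space_seed UNIV_I simp_thms)
qed

lemma AE_hits_negligible:
  assumes "\<And>i. finite (S i)" "\<And>i. card (S i) \<le> i"
  shows "AE w in seed. (\<lambda>i. real (card {s \<in> S i. sched w s \<noteq> None}) / real i) \<longlonglongrightarrow> 0"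
proof -
  \<comment> \<open>Countably many values of \<epsilon> suffice for convergence, and they share one
    null set.\<close>
  have "AE w in seed. \<forall>n. \<forall>\<^sub>F i in sequentially.
      real (card {s \<in> S i. sched w s \<noteq> None}) < 2 * (1 / real (Suc n)) * real i"
    unfolding AE_all_countable by (intro allI AE_eventually_few_hits assms) simp
  then show ?thesis
  proof (rule AE_mp, intro AE_I2 impI)
    fix w assume *: "\<forall>n. \<forall>\<^sub>F i in sequentially.
      real (card {s \<in> S i. sched w s \<noteq> None}) < 2 * (1 / real (Suc n)) * real i"
    show "(\<lambda>i. real (card {s \<in> S i. sched w s \<noteq> None}) / real i) \<longlonglongrightarrow> 0"
    proof (rule tendstoI)
      fix r :: real assume "0 < r"
      then obtain n where n: "1 / real (Suc n) < r / 2"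
        using reals_Archimedean[of "r / 2"] by (auto simp: inverse_eq_divide)
      from spec[OF *, of n] eventually_gt_at_top[of 0]
      show "\<forall>\<^sub>F i in sequentially. dist (real (card {s \<in> S i. sched w s \<noteq> None}) / real i) 0 < r"
      proof eventually_elim
        case (elim i)
        have "real (card {s \<in> S i. sched w s \<noteq> None}) / real i < 2 * (1 / real (Suc n))"
          using elim by (simp only: pos_divide_less_eq of_nat_0_less_iff)
        with n have "real (card {s \<in> S i. sched w s \<noteq> None}) / real i < r" by linarith
        then show ?case by (simp add: dist_real_def)
      qed
    qed
  qed
qed

end

section \<open>Measurability of the procedure in the seed\<close>

lemma measurable_map_upt:
  fixes e :: "'w \<Rightarrow> nat \<Rightarrow> 'b::countable"
  assumes [measurable]: "\<And>s. (\<lambda>w. e w s) \<in> measurable M (count_space UNIV)"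
  shows "(\<lambda>w. map (e w) [0..<n]) \<in> measurable M (count_space UNIV)"
proof -
  have "(\<lambda>w. map (e w) [0..<n]) -` {l} \<inter> space M \<in> sets M" for l
  proof (cases "length l = n")
    case True
    then have "map (e w) [0..<n] = l \<longleftrightarrow> (\<forall>s\<in>{..<n}. e w s = l ! s)" for w
      by (subst list_eq_iff_nth_eq) auto
    then have "(\<lambda>w. map (e w) [0..<n]) -` {l} \<inter> space M = {w \<in> space M. \<forall>s\<in>{..<n}. e w s = l ! s}"
      by blast
    also have "\<dots> \<in> sets M" by measurable
    finally show ?thesis .
  next
    case False
    then have "(\<lambda>w. map (e w) [0..<n]) -` {l} \<inter> space M = {}" by auto
    then show ?thesis by simp
  qed
  then show ?thesis
    by (simp add: measurable_count_space_eq2_countable)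
qed

text \<open>The output depends on the schedule only through a finite list of its entries. That list
  is measurable with countably many values, and \<open>?G\<close> runs the same procedure with the
  list as its seed, on a discrete space.\<close>

lemma measurable_explore_proc:
  assumes "\<And>s. (\<lambda>w. e w s) \<in> measurable M (count_space UNIV)"
  shows "(\<lambda>w. explore_proc u e w L xs ys) \<in> measurable M (count_space UNIV)"
proof -
  let ?n = "Suc (length xs)"
  let ?G = "\<lambda>l. explore_proc u (\<lambda>l s. l ! s) l L xs ys"
  have "explore_proc u e w L xs ys = ?G (map (e w) [0..<?n])" for w
  proof -
    let ?e' = "\<lambda>s. map (e w) [0..<?n] ! s" and ?t = "length xs - 1"
    have "past u (e w) L (\<lambda>i. xs ! i) (\<lambda>i. ys ! i) ?t = past u ?e' L (\<lambda>i. xs ! i) (\<lambda>i. ys ! i) ?t"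
      by (rule past_cong) (auto simp del: upt_Suc)
    moreover have "step u (e w) L (\<lambda>i. xs ! i) (\<lambda>i. ys ! i) ?t A
        = step u ?e' L (\<lambda>i. xs ! i) (\<lambda>i. ys ! i) ?t A" for A
      by (rule step_cong) (auto simp del: upt_Suc)
    ultimately show ?thesis
      by (simp add: explore_proc_def Let_def del: upt_Suc)
  qed
  moreover have "(\<lambda>w. ?G (map (e w) [0..<?n])) \<in> measurable M (count_space UNIV)"
    by (rule measurable_compose[OF measurable_map_upt[OF assms]]) simp
  ultimately show ?thesis by simp
qed

section \<open>Choosing the blocks for a feasible profile\<close>

text \<open>Take for \<open>g n\<close> the largest \<open>c\<close> up to \<open>n\<close> such
  that \<open>Q c\<close> holds from \<open>n\<close> on. The cap makes the maximum exist,
  \<open>Q 0\<close> makes the set nonempty, and demanding \<open>Q c\<close> for all later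
  arguments makes \<open>g\<close> monotone.\<close>

lemma slow_growth:
  fixes Q :: "nat \<Rightarrow> nat \<Rightarrow> bool"
  assumes "\<And>n. Q 0 n" and "\<And>c. \<forall>\<^sub>F n in sequentially. Q c n"
  obtains g where "mono g" "\<And>n. Q (g n) n" "filterlim g at_top sequentially"
proof
  define A where "A n = {c. c \<le> n \<and> (\<forall>k\<ge>n. Q c k)}" for n
  have fin: "finite (A n)" for n
    by (rule finite_subset[of _ "{..n}"]) (auto simp: A_def)
  have ne: "A n \<noteq> {}" for n
    using assms(1) by (auto simp: A_def intro!: exI[of _ 0])
  show "mono (\<lambda>n. Max (A n))"
    by (intro monoI Max_mono fin ne) (auto simp: A_def)
  have in_A: "Max (A n) \<in> A n" for n
    by (rule Max_in[OF fin ne])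
  then show "Q (Max (A n)) n" for n
    by (simp add: A_def)
  show "filterlim (\<lambda>n. Max (A n)) at_top sequentially"
    unfolding filterlim_at_top
  proof
    fix c
    obtain N where N: "\<And>k. N \<le> k \<Longrightarrow> Q c k"
      using assms(2)[of c] by (auto simp: eventually_sequentially)
    show "\<forall>\<^sub>F n in sequentially. c \<le> Max (A n)"
      using eventually_ge_at_top[of "max N c"]
      by eventually_elim (rule Max_ge[OF fin], auto simp: A_def N)
  qed
qed

text \<open>Bounded increments would make \<open>D\<close> grow at most linearly; non-decreasing
  unbounded increments tend to infinity.\<close>

lemma convex_superlinear_increments:
  fixes D :: "nat \<Rightarrow> nat"
  assumes conv: "mono_on {1..} (\<lambda>n. D (n + 1) - D n)"
    and superlin: "filterlim (\<lambda>n. real (D n) / real n) at_top sequentially"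
  shows "filterlim (\<lambda>n. D (n + 1) - D n) at_top sequentially"
  unfolding filterlim_at_top
proof
  fix c :: nat
  have "\<exists>n\<ge>1. c \<le> D (n + 1) - D n"
  proof (rule ccontr)
    assume contra: "\<not> ?thesis"
    have small: "D (n + 1) \<le> D n + c" if "1 \<le> n" for n
    proof -
      have "D (n + 1) - D n < c"
        using contra that by (meson not_le)
      then show ?thesis by linarith
    qed
    have bound: "D n \<le> D 1 + c * n" if "1 \<le> n" for n
      using that
    proof (induction n rule: dec_induct)
      case (step n)
      then show ?case using small[of n] by simp
    qed simp
    \<comment> \<open>For positive \<open>n\<close> the linear bound is at most
      \<open>(D 1 + c) * n\<close>, so a slope larger by 1 is contradictory.\<close>
    have "\<forall>\<^sub>F n in sequentially. real (D 1 + c) + 1 \<le> real (D n) / real n"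
      using superlin by (simp add: filterlim_at_top)
    then obtain N where N: "\<And>n. N \<le> n \<Longrightarrow> real (D 1 + c) + 1 \<le> real (D n) / real n"
      by (auto simp: eventually_sequentially)
    define n where "n = max N 1"
    have n: "1 \<le> n" "N \<le> n" by (auto simp: n_def)
    have "(real (D 1 + c) + 1) * real n \<le> real (D n)"
      using N[OF n(2)] n(1) by (simp add: pos_le_divide_eq)
    also have "\<dots> \<le> real (D 1 + c * n)"
      using bound[OF n(1)] by (rule of_nat_mono)
    also have "\<dots> \<le> (real (D 1 + c)) * real n"
      using n(1) mult_left_mono[of 1 "real n" "real (D 1)"] by (simp add: algebra_simps)
    finally show False using n(1) by (simp add: algebra_simps)
  qed
  then obtain n where n: "1 \<le> n" "c \<le> D (n + 1) - D n" by blast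
  show "\<forall>\<^sub>F k in sequentially. c \<le> D (k + 1) - D k"
    using eventually_ge_at_top[of n]
  proof eventually_elim
    case (elim k)
    then have "D (n + 1) - D n \<le> D (k + 1) - D k"
      using n(1) by (intro mono_onD[OF conv]) auto
    with n(2) show ?case by linarith
  qed
qed

text \<open>The second conjunct makes the explorations of each language lag behind \<open>i\<close>
  by at most a constant at time \<open>D i\<close>. In the third, \<open>T\<close> stands for the
  outputs lost before \<open>B\<close> is consistent.\<close>

lemma exploration_blocks_exist:
  assumes "feasible_profile D H"
  shows "\<exists>Bl a q (lab :: nat \<Rightarrow> nat). block_schedule Bl a q \<and>
    (\<forall>m. \<exists>c. \<forall>i. i \<le> card {b \<in> Bl. lab b = m \<and> a b + q b \<le> D i} + c) \<and>
    (\<forall>T::nat. \<forall>\<^sub>F t in sequentially.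
      finite {b \<in> Bl. a b < t} \<and> real T + real (card {b \<in> Bl. a b < t}) \<le> real t * H t)"
proof -
  have mono: "mono_on {1..} D" and conv: "mono_on {1..} (\<lambda>n. D (n + 1) - D n)"
    and superlin: "filterlim (\<lambda>n. real (D n) / real n) at_top sequentially"
    and H0: "\<And>t. 1 \<le> t \<Longrightarrow> 0 \<le> H t"
    and omega: "H \<in> \<omega>(\<lambda>t. real (D_inv D t) / real t)"
    using assms by (auto simp: feasible_profile_def)
  have D_le: "D i \<le> D j" if "1 \<le> i" "i \<le> j" for i j
    using that by (intro mono_onD[OF mono]) auto
  have incr: "filterlim (\<lambda>n. D (n + 1) - D n) at_top sequentially"
    by (rule convex_superlinear_increments[OF conv superlin])
  have unbounded: "\<exists>n. 1 \<le> n \<and> t \<le> D n" for t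
  proof -
    have "\<forall>\<^sub>F n in sequentially. t \<le> D (n + 1) - D n"
      using incr by (simp add: filterlim_at_top)
    then obtain n where "t \<le> D (n + 1) - D n"
      by (auto simp: eventually_sequentially)
    then show ?thesis by (intro exI[of _ "n + 1"]) auto
  qed
  have D_inv: "1 \<le> D_inv D t" "t \<le> D (D_inv D t)" for t
    using LeastI_ex[OF unbounded[of t]] by (auto simp: D_inv_def)
  have D_inv_le: "D_inv D t \<le> n" if "1 \<le> n" "t \<le> D n" for t n
    unfolding D_inv_def using that by (intro Least_le) simp
  have D_inv_mono: "D_inv D s \<le> D_inv D t" if "s \<le> t" for s t
    using that D_inv[of t] by (intro D_inv_le) auto
  have less_D_inv: "n < D_inv D t" if "1 \<le> n" "D n < t" for n t
  proof (rule ccontr)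
    assume "\<not> n < D_inv D t"
    then have "D (D_inv D t) \<le> D n"
      using D_inv(1) by (intro D_le) auto
    with D_inv(2)[of t] that show False by linarith
  qed
  have omega': "\<forall>\<^sub>F t in sequentially. c * real (D_inv D t) \<le> real t * H t" if "0 < c" for c :: real
    using smallomegaD[OF omega, of c] eventually_ge_at_top[of 1]
  proof eventually_elim
    case (elim t)
    then have "c * (real (D_inv D t) / real t) \<le> H t"
      using H0[of t] by simp
    then show ?case
      using elim by (simp add: field_simps)
  qed
  \<comment> \<open>The square makes room for \<open>c\<close> blocks of length at least
    \<open>c\<close>, so that lengths grow with \<open>g\<close>. The factor 2 reserves half of
    \<open>t * H t\<close> for the constant \<open>T\<close>.\<close>
  define Q where "Q c n \<longleftrightarrow> c * c \<le> D (n + 1) - D n \<and>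
      (\<forall>t\<ge>1. D_inv D t = n \<longrightarrow> 2 * real (n * c) \<le> real t * H t)" for c n
  have "Q 0 n" for n
    using H0 by (simp add: Q_def)
  moreover have "\<forall>\<^sub>F n in sequentially. Q c n" for c
  proof -
    \<comment> \<open>\<open>Suc c\<close> keeps the factor positive when \<open>c\<close> is
      0.\<close>
    obtain t0 where t0: "\<And>t. t0 \<le> t \<Longrightarrow> 2 * real (Suc c) * real (D_inv D t) \<le> real t * H t"
      using omega'[of "2 * real (Suc c)"] by (auto simp: eventually_sequentially)
    have "\<forall>\<^sub>F n in sequentially. c * c \<le> D (n + 1) - D n"
      using incr by (simp add: filterlim_at_top)
    then show ?thesis
      using eventually_gt_at_top[of "D_inv D t0"]
    proof eventually_elim
      case (elim n)
      have "2 * real (n * c) \<le> real t * H t" if "D_inv D t = n" for t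
      proof -
        have "t0 \<le> t"
          using D_inv_mono[of t t0] elim that by linarith
        from t0[OF this] that have "2 * real (Suc c) * real n \<le> real t * H t" by simp
        moreover have "2 * real (n * c) \<le> 2 * real (Suc c) * real n"
          by (simp add: algebra_simps)
        ultimately show ?thesis by linarith
      qed
      with elim show ?case by (simp add: Q_def)
    qed
  qed
  ultimately obtain g where g_mono: "mono g" and g: "\<And>n. Q (g n) n"
    and g_lim: "filterlim g at_top sequentially"
    using slow_growth[of Q] by blast
  \<comment> \<open>The maximum gives a positive length even when \<open>g i\<close> is 0 and the
    quotient is 0 by convention. For actual blocks the quotient is at least 1, by the square bound
    in \<open>Q\<close>.\<close>
  define len where "len i = max 1 ((D (i + 1) - D i) div g i)" for i
  \<comment> \<open>The pair \<open>(i, m)\<close> codes the block for language \<open>m\<close>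
    among \<open>g i\<close> consecutive blocks between \<open>D i\<close> and
    \<open>D (i + 1)\<close>. Numbering starts at 1 because \<open>D 0\<close> is arbitrary.\<close>
  define Bl where "Bl = prod_encode ` (SIGMA i:{1..}. {..<g i})"
  define a where "a b = (case prod_decode b of (i, m) \<Rightarrow> D i + m * len i)" for b
  define q where "q b = len (fst (prod_decode b))" for b
  define lab where "lab b = snd (prod_decode b)" for b
  have BlE: "\<exists>i m. b = prod_encode (i, m) \<and> 1 \<le> i \<and> m < g i" if "b \<in> Bl" for b
    using that by (auto simp: Bl_def)
  have a_eq: "a (prod_encode (i, m)) = D i + m * len i" and q_eq: "q (prod_encode (i, m)) = len i"
    and lab_eq: "lab (prod_encode (i, m)) = m" for i m
    by (simp_all add: a_def q_def lab_def)
  have len_ge: "g i \<le> len i" for i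
  proof (cases "g i = 0")
    case False
    have "g i * g i \<le> D (i + 1) - D i"
      using g[of i] by (simp add: Q_def)
    then have "g i \<le> (D (i + 1) - D i) div g i"
      using False by (simp add: less_eq_div_iff_mult_less_eq)
    then show ?thesis by (simp add: len_def)
  qed simp
  have block_end: "D i + m * len i + len i \<le> D (i + 1)" if "1 \<le> i" "m < g i" for i m
  proof -
    have gpos: "0 < g i" using that by simp
    have "g i * g i \<le> D (i + 1) - D i"
      using g[of i] by (simp add: Q_def)
    then have "1 \<le> (D (i + 1) - D i) div g i"
      using gpos by (simp add: less_eq_div_iff_mult_less_eq) (meson dual_order.trans le_square)
    then have "len i = (D (i + 1) - D i) div g i"
      by (simp add: len_def)
    then have "g i * len i \<le> D (i + 1) - D i"
      by simp
    moreover have "(m + 1) * len i \<le> g i * len i"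
      using that by (intro mult_le_mono1) simp
    ultimately have "m * len i + len i \<le> D (i + 1) - D i" by simp
    moreover have "D i \<le> D (i + 1)" using that by (intro D_le) auto
    ultimately show ?thesis by linarith
  qed
  have ordered: "D i + m * len i + len i \<le> D i' + m' * len i'"
    if "1 \<le> i" "m < g i" "i < i' \<or> i = i' \<and> m < m'" for i m i' m'
  proof (cases "i < i'")
    case True
    have "D (i + 1) \<le> D i'" using True that by (intro D_le) auto
    with block_end[OF that(1,2)] show ?thesis by linarith
  next
    case False
    with that have "i = i'" "m < m'" by auto
    then have "(m + 1) * len i \<le> m' * len i'"
      by (intro mult_le_mono) auto
    then show ?thesis using \<open>i = i'\<close> by simp
  qed
  have "block_schedule Bl a q"
  proof
    show "0 < q b" for b by (simp add: q_def len_def)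
  next
    fix b b' assume "b \<in> Bl" "b' \<in> Bl" "b \<noteq> b'"
    then obtain i m i' m' where b: "b = prod_encode (i, m)" "1 \<le> i" "m < g i"
      and b': "b' = prod_encode (i', m')" "1 \<le> i'" "m' < g i'" and ne: "(i, m) \<noteq> (i', m')"
      using BlE by metis
    from ne consider "i < i' \<or> i = i' \<and> m < m'" | "i' < i \<or> i' = i \<and> m' < m"
      by fastforce
    then have "a b + q b \<le> a b' \<or> a b' + q b' \<le> a b"
      using ordered[of i m i' m'] ordered[of i' m' i m] b b' by (auto simp: a_eq q_eq)
    then show "{a b..<a b + q b} \<inter> {a b'..<a b' + q b'} = {}"
      by auto
  next
    fix c
    obtain i0 where i0: "\<And>i. i0 \<le> i \<Longrightarrow> Suc c \<le> g i"
      using g_lim unfolding filterlim_at_top eventually_sequentially by blast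
    have "{b \<in> Bl. q b \<le> c} \<subseteq> prod_encode ` ({..i0} \<times> {..c})"
    proof
      fix b assume "b \<in> {b \<in> Bl. q b \<le> c}"
      then obtain i m where b: "b = prod_encode (i, m)" "m < g i" "q b \<le> c"
        using BlE by blast
      then have "g i \<le> c" using len_ge[of i] by (simp add: q_eq)
      then have "i \<le> i0" "m \<le> c" using i0[of i] b by (auto simp: not_le intro: leI)
      then show "b \<in> prod_encode ` ({..i0} \<times> {..c})" using b by auto
    qed
    then show "finite {b \<in> Bl. q b \<le> c}"
      by (rule finite_subset) simp
  qed
  moreover have "\<exists>c. \<forall>i. i \<le> card {b \<in> Bl. lab b = m \<and> a b + q b \<le> D i} + c" for m
  proof -
    obtain i0 where i0: "\<And>i. i0 \<le> i \<Longrightarrow> Suc m \<le> g i"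
      using g_lim unfolding filterlim_at_top eventually_sequentially by blast
    \<comment> \<open>Every interval index \<open>j\<close> with \<open>i0 < j < i\<close> supplies
      a block for language \<open>m\<close> that ends by \<open>D i\<close>; the
      \<open>Suc i0\<close> indices up to \<open>i0\<close> may supply none.\<close>
    have "i \<le> card {b \<in> Bl. lab b = m \<and> a b + q b \<le> D i} + Suc i0" for i
    proof (cases "i = 0")
      case False
      let ?J = "{Suc i0..<i}"
      have "card ?J = card ((\<lambda>j. prod_encode (j, m)) ` ?J)"
        by (rule card_image[symmetric]) (auto intro!: inj_onI)
      also have "\<dots> \<le> card {b \<in> Bl. lab b = m \<and> a b + q b \<le> D i}"
      proof (rule card_mono)
        \<comment> \<open>Finiteness matters here because the cardinality of an infinite set is 0 by
          convention.\<close>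
        show "finite {b \<in> Bl. lab b = m \<and> a b + q b \<le> D i}"
        proof (rule finite_subset)
          show "{b \<in> Bl. lab b = m \<and> a b + q b \<le> D i} \<subseteq> (\<lambda>j. prod_encode (j, m)) ` {..<i}"
          proof
            fix b assume "b \<in> {b \<in> Bl. lab b = m \<and> a b + q b \<le> D i}"
            then obtain j where b: "b = prod_encode (j, m)" "1 \<le> j" "D j + m * len j + len j \<le> D i"
              using BlE by (fastforce simp: a_eq q_eq lab_eq)
            have "1 \<le> len j" by (simp add: len_def)
            with b have "\<not> D i \<le> D j" by linarith
            then have "j < i" using D_le[of i j] False by linarith
            with b show "b \<in> (\<lambda>j. prod_encode (j, m)) ` {..<i}" by auto
          qed
        qed simp
        show "(\<lambda>j. prod_encode (j, m)) ` ?J \<subseteq> {b \<in> Bl. lab b = m \<and> a b + q b \<le> D i}"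
        proof
          fix b assume "b \<in> (\<lambda>j. prod_encode (j, m)) ` ?J"
          then obtain j where b: "b = prod_encode (j, m)" "i0 < j" "j < i" by auto
          then have j: "1 \<le> j" "m < g j" using i0[of j] by auto
          have "D (j + 1) \<le> D i" using b by (intro D_le) auto
          with block_end[OF j] have "a b + q b \<le> D i" by (simp add: b a_eq q_eq)
          with j show "b \<in> {b \<in> Bl. lab b = m \<and> a b + q b \<le> D i}"
            using b by (auto simp: Bl_def lab_eq)
        qed
      qed
      finally show ?thesis by simp
    qed simp
    then show ?thesis by blast
  qed
  moreover have "\<forall>\<^sub>F t in sequentially.
      finite {b \<in> Bl. a b < t} \<and> real T + real (card {b \<in> Bl. a b < t}) \<le> real t * H t" for T
    using omega'[of "2 * real (Suc T)", simplified] eventually_ge_at_top[of 1]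
  proof eventually_elim
    case (elim t)
    let ?n = "D_inv D t"
    \<comment> \<open>A block starting before \<open>t\<close> belongs to an interval with
      \<open>D i < t\<close>, so \<open>i\<close> is below \<open>?n\<close>, and monotonicity of
      \<open>g\<close> bounds its label.\<close>
    have sub: "{b \<in> Bl. a b < t} \<subseteq> prod_encode ` ({..<?n} \<times> {..<g ?n})"
    proof
      fix b assume "b \<in> {b \<in> Bl. a b < t}"
      then obtain i m where b: "b = prod_encode (i, m)" "1 \<le> i" "m < g i" "D i + m * len i < t"
        using BlE by (fastforce simp: a_eq)
      then have "i < ?n" by (intro less_D_inv) auto
      then have "g i \<le> g ?n" by (intro monoD[OF g_mono]) simp
      with b \<open>i < ?n\<close> show "b \<in> prod_encode ` ({..<?n} \<times> {..<g ?n})" by auto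
    qed
    have "card {b \<in> Bl. a b < t} \<le> card (prod_encode ` ({..<?n} \<times> {..<g ?n}))"
      using sub by (intro card_mono) auto
    also have "\<dots> = ?n * g ?n"
      by (subst card_image) (auto intro: inj_on_subset[OF inj_prod_encode])
    finally have "real (card {b \<in> Bl. a b < t}) \<le> real (?n * g ?n)"
      by (rule of_nat_mono)
    moreover have "2 * real (?n * g ?n) \<le> real t * H t"
      using g[of ?n] elim by (simp add: Q_def)
    \<comment> \<open>The other half of \<open>t * H t\<close> pays for \<open>T\<close>, since
      \<open>?n\<close> is at least 1.\<close>
    moreover have "2 * real T \<le> real t * H t"
    proof -
      have "2 * real T * 1 \<le> 2 * real (Suc T) * real ?n"
        using D_inv(1)[of t] by (intro mult_mono) auto
      then show ?thesis using elim by simp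
    qed
    ultimately show ?case
      using finite_subset[OF sub] by simp
  qed
  ultimately show ?thesis by blast
qed

section \<open>The randomized generator\<close>

text \<open>A bound valid for every seed passes to the expectation, whether or not the integrand is
  known to be integrable.\<close>

lemma halluc_rate_le:
  assumes "prob_space M" and "\<And>w. card (outputs_upto (A w) L X t - K) \<le> N"
    and "real N \<le> real t * h" and "1 \<le> t"
  shows "halluc_rate M A L K X t \<le> h"
proof -
  interpret prob_space M by fact
  let ?f = "\<lambda>w. real (card (outputs_upto (A w) L X t - K)) / real t"
  have le: "?f w \<le> h" for w
  proof -
    have "real (card (outputs_upto (A w) L X t - K)) \<le> real t * h"
      using assms(2)[of w] assms(3) by linarith
    then show ?thesis using assms(4) by (simp add: field_simps)
  qed
  show ?thesis
  proof (cases "integrable M ?f")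
    case True
    then show ?thesis
      unfolding halluc_rate_def using le by (intro integral_le_const) auto
  next
    \<comment> \<open>The integral is then 0 by convention, and \<open>h\<close> is nonnegative
      because it bounds a nonnegative ratio.\<close>
    case False
    have "0 \<le> ?f w" for w by simp
    with le have "0 \<le> h" by (meson order_trans)
    then show ?thesis
      using not_integrable_integral_eq[OF False] unfolding halluc_rate_def by linarith
  qed
qed

text \<open>Superadditivity of the lower limit. The perturbation \<open>h\<close> will be the share
  of uncovered elements and lost answers.\<close>

lemma liminf_ge_perturb:
  fixes f g h :: "nat \<Rightarrow> real"
  assumes f: "ereal \<rho> \<le> liminf (\<lambda>i. ereal (f i))" and h: "h \<longlonglongrightarrow> 0"
    and le: "\<forall>\<^sub>F i in sequentially. f i \<le> g i + h i"
  shows "ereal \<rho> \<le> liminf (\<lambda>i. ereal (g i))"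
proof -
  have "(\<lambda>i. ereal (- h i)) \<longlonglongrightarrow> ereal (- 0)"
    using h by (intro tendsto_intros)
  then have lim0: "liminf (\<lambda>i. ereal (- h i)) = 0"
    by (simp only: lim_imp_Liminf[OF sequentially_bot] minus_zero zero_ereal_def)
  have "ereal \<rho> + 0 \<le> liminf (\<lambda>i. ereal (f i)) + liminf (\<lambda>i. ereal (- h i))"
    using f by (simp only: lim0 add_mono order_refl)
  also have "\<dots> \<le> liminf (\<lambda>i. ereal (f i) + ereal (- h i))"
    using f by (intro ereal_liminf_add_mono) (auto simp: lim0)
  also have "\<dots> \<le> liminf (\<lambda>i. ereal (g i))"
    using le by (intro Liminf_mono) (auto elim!: eventually_mono)
  finally show ?thesis by simp
qed

theorem lemma9:
  fixes u :: "nat \<Rightarrow> 'u"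
    and DM :: "'u data_model"
    and \<rho> :: real
    and D :: "nat \<Rightarrow> nat"
    and H :: "nat \<Rightarrow> real"
  assumes "bij u"
    and "0 \<le> \<rho>" and "\<rho> \<le> 1"
    and "feasible_profile D H"
  shows "\<exists>(M :: (nat \<Rightarrow> real) measure) (P :: (nat \<Rightarrow> real, 'u) black_box_proc).
           \<forall>B :: 'u gen.
             generator B \<and> eventually_consistent DM B \<and> mu_low u DM B = ereal \<rho> \<longrightarrow>
             (let A = run_black_box P B in
                randomized_generator M A \<and>
                mu_pfx_low_ge_AE u DM M A D \<rho> \<and>
                (\<forall>L. collection L \<longrightarrow>
                   (\<forall>T. \<forall>\<^sub>F t in sequentially. sup_halluc_rate DM M A B L T t \<le> ereal (H t))))"
proof -
  \<comment> \<open>The blocks come from \<open>D\<close> and \<open>H\<close> alone, so the seed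
    space and the procedure are fixed before \<open>B\<close>.\<close>
  obtain Bl a q and lab :: "nat \<Rightarrow> nat" where blocks: "block_schedule Bl a q"
    and enough: "\<And>m. \<exists>c. \<forall>i. i \<le> card {b \<in> Bl. lab b = m \<and> a b + q b \<le> D i} + c"
    and few: "\<And>T. \<forall>\<^sub>F t in sequentially.
      finite {b \<in> Bl. a b < t} \<and> real T + real (card {b \<in> Bl. a b < t}) \<le> real t * H t"
    using exploration_blocks_exist[OF assms(4)] by blast
  interpret S: block_schedule Bl a q lab by (rule blocks)
  let ?e = "S.sched"
  let ?A = "run_black_box (explore_proc u ?e)"
  have "randomized_generator S.seed (?A B) \<and> mu_pfx_low_ge_AE u DM S.seed (?A B) D \<rho> \<and>
      (\<forall>L. collection L \<longrightarrow>
         (\<forall>T. \<forall>\<^sub>F t in sequentially. sup_halluc_rate DM S.seed (?A B) B L T t \<le> ereal (H t)))"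
    if B: "generator B" and low: "mu_low u DM B = ereal \<rho>" for B :: "'u gen"
  proof (intro conjI allI impI)
    show "randomized_generator S.seed (?A B)"
      unfolding randomized_generator_def run_black_box_def
      using S.prob_space_seed generator_run_explore_proc[OF assms(1) B, of ?e]
      by (auto simp: run_black_box_def[abs_def] intro: measurable_explore_proc S.measurable_sched)
    show "mu_pfx_low_ge_AE u DM S.seed (?A B) D \<rho>"
      unfolding mu_pfx_low_ge_AE_def
    proof (intro allI impI ballI)
      fix L K X assume L: "collection L" and K: "K \<in> range L" and X: "X \<in> DM K"
      let ?y = "\<lambda>s. outp B L X (Suc s)"
      \<comment> \<open>The times at which \<open>B\<close> answers in the prefix: at most
        \<open>i\<close> of them by injectivity, and determined by \<open>B\<close>,
        \<open>L\<close> and \<open>X\<close> without the seed.\<close>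
      let ?S = "\<lambda>i. {s. ?y s \<in> lang_prefix u K i}"
      let ?f = "\<lambda>i. real (card (all_outputs B L X \<inter> lang_prefix u K i)) / real i"
      from K obtain m where m: "K = L m" by blast
      have y_inj: "inj ?y" by (rule inj_outp[OF B L])
      have y_new: "?y s \<notin> X ` {..s}" for s
        using generator_fresh[OF B L, of "Suc s" X] by (simp add: lessThan_Suc_atMost)
      have "finite (?y -` lang_prefix u K i)" for i
        by (intro finite_vimageI finite_lang_prefix y_inj)
      then have S_fin: "finite (?S i)" for i
        by (simp add: vimage_def)
      have S_card: "card (?S i) \<le> i" for i
      proof -
        have "card (?S i) = card (?y ` ?S i)"
          by (rule card_image[symmetric], rule inj_on_subset[OF y_inj subset_UNIV])
        also have "\<dots> \<le> card (lang_prefix u K i)"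
          by (intro card_mono finite_lang_prefix) auto
        finally show ?thesis using card_lang_prefix_le[of u K i] by linarith
      qed
      have range_y: "range ?y = all_outputs B L X"
      proof -
        have "{1..} = range Suc" by (auto simp: image_iff intro: Suc_le_D)
        then show ?thesis by (simp add: all_outputs_def image_image)
      qed
      have "mu_low u DM B \<le> liminf (\<lambda>i. ereal (?f i))"
        unfolding mu_low_def using L K X
        by (intro INF_lower2[of L] INF_lower2[of K] INF_lower2[of X]) auto
      then have low': "ereal \<rho> \<le> liminf (\<lambda>i. ereal (?f i))"
        by (simp only: low)
      obtain c where c: "\<And>i. i \<le> card {b \<in> Bl. lab b = m \<and> a b + q b \<le> D i} + c"
        using enough by blast
      show "AE w in S.seed. ereal \<rho> \<le> liminf (\<lambda>i. ereal (mu_pfx u (?A B w) L K X D i))"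
      proof (rule AE_mp[OF S.AE_hits_negligible[OF S_fin S_card]], intro AE_I2 impI)
        fix w
        let ?r = "\<lambda>i. real (card {s \<in> ?S i. ?e w s \<noteq> None}) / real i"
        assume r: "?r \<longlonglongrightarrow> 0"
        have "(\<lambda>i. real c / real i + ?r i) \<longlonglongrightarrow> 0 + 0"
          using r by (intro tendsto_add lim_const_over_n)
        then have h: "(\<lambda>i. real c / real i + ?r i) \<longlonglongrightarrow> 0"
          by simp
        have "?f i \<le> mu_pfx u (?A B w) L K X D i + (real c / real i + ?r i)" for i
        proof -
          have "i \<le> card {s. s < D i \<and> ?e w s = Some m} + c"
            using c[of i] S.card_sched_label_ge[of m "D i" w] by linarith
          then have "card (range ?y \<inter> lang_prefix u (L m) i)
            \<le> card (past u (?e w) L X ?y (D i) \<inter> lang_prefix u (L m) i) + c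
              + card {s. ?y s \<in> lang_prefix u (L m) i \<and> ?e w s \<noteq> None}"
            using L by (intro card_answers_prefix_le assms y_inj y_new) (auto simp: collection_def)
          then have "card (all_outputs B L X \<inter> lang_prefix u K i)
            \<le> card (outputs_upto (?A B w) L X (D i) \<inter> lang_prefix u K i) + c
              + card {s \<in> ?S i. ?e w s \<noteq> None}"
            by (simp only: range_y m outputs_upto_run_explore_proc mem_Collect_eq)
          then have "real (card (all_outputs B L X \<inter> lang_prefix u K i))
            \<le> real (card (outputs_upto (?A B w) L X (D i) \<inter> lang_prefix u K i)) + real c
              + real (card {s \<in> ?S i. ?e w s \<noteq> None})"
            by linarith
          then have "?f i \<le> (real (card (outputs_upto (?A B w) L X (D i) \<inter> lang_prefix u K i)) + real c
              + real (card {s \<in> ?S i. ?e w s \<noteq> None})) / real i"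
            by (rule divide_right_mono) simp
          then show ?thesis
            by (simp only: mu_pfx_def add_divide_distrib add.assoc)
        qed
        then show "ereal \<rho> \<le> liminf (\<lambda>i. ereal (mu_pfx u (?A B w) L K X D i))"
          by (intro liminf_ge_perturb[OF low' h] always_eventually) blast
      qed
    qed
  next
    fix L :: "'u collection" and T assume L: "collection L"
    show "\<forall>\<^sub>F t in sequentially. sup_halluc_rate DM S.seed (?A B) B L T t \<le> ereal (H t)"
      using few[of T] eventually_ge_at_top[of 1]
    proof eventually_elim
      case (elim t)
      \<comment> \<open>The bound \<open>T + card {b \<in> Bl. a b < t}\<close> depends on neither
        \<open>K\<close> nor \<open>X\<close>, so one threshold on \<open>t\<close> serves the whole
        supremum.\<close>
      have "halluc_rate S.seed (?A B) L K X t \<le> H t" if "consistent_from B L K X T" for K X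
      proof (rule halluc_rate_le[OF S.prob_space_seed])
        fix w
        let ?y = "\<lambda>s. outp B L X (Suc s)"
        have "card (past u (?e w) L X ?y t - K) \<le> T + card {s. s < t \<and> ?e w s \<noteq> None}"
          using that by (intro card_past_outside_le inj_outp[OF B L]) (auto simp: consistent_from_def)
        also have "\<dots> \<le> T + card {b \<in> Bl. a b < t}"
          using elim by (intro add_left_mono S.card_sched_le) simp
        finally show "card (outputs_upto (?A B w) L X t - K) \<le> T + card {b \<in> Bl. a b < t}"
          by (simp only: outputs_upto_run_explore_proc)
      qed (use elim in auto)
      then show ?case
        unfolding sup_halluc_rate_def by (intro SUP_least) auto
    qed
  qed
  then show ?thesis
    unfolding Let_def by blast
qed

end
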